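(* Let $f\in\mathcal{S}^{*}_{\mathcal{B}}$. Then $|H_2(3)|\leq \frac{1}{36}$. This bound is sharp, that is, there exists $f\in\mathcal{S}^{*}_{\mathcal{B}}$ for which equality holds.
   Context: Let $\mathbb{D}=\{z\in\mathbb{C}:|z|<1\}$. Let $\mathcal{A}$ be the class of analytic functions $f$ on $\mathbb{D}$ of the form $f(z)=z+\sum_{n=2}^{\infty}a_nz^n$. For analytic functions $h,g$ on $\mathbb{D}$, $h\prec g$ ($h$ is subordinate to $g$) means that there is an analytic function $w$ on $\mathbb{D}$ with $w(0)=0$ and $|w(z)|\le |z|$ (a Schwarz function) such that $h(z)=g(w(z))$ for $z \in \mathbb{D}$. The class $\mathcal{S}^{*}_{\mathcal{B}}$ is $$\mathcal{S}^{*}_{\mathcal{B}}=\left\{f\in\mathcal{A}:\ \frac{zf'(z)}{f(z)}\prec\sqrt{1+\tanh z}\right\},$$ where the branch of the square root is the one with value $1$ at $z=0$. For $f(z)=z+\sum_{n=2}^{\infty}a_nz^n\in\mathcal{A}$, the second Hankel determinant $H_2(3)$ is $H_2(3)=a_3a_5-a_4^2$. *)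

theory Defs
  imports "HOL-Complex_Analysis.Complex_Analysis"
begin

abbreviation unit_disc :: "complex set" where
  "unit_disc \<equiv> ball 0 1"

definition taylor_coeff :: "(complex \<Rightarrow> complex) \<Rightarrow> nat \<Rightarrow> complex" where
  "taylor_coeff f n = fps_nth (fps_expansion f 0) n"

definition class_A :: "(complex \<Rightarrow> complex) set" where
  "class_A = {f. f holomorphic_on unit_disc \<and>
     (\<forall>z\<in>unit_disc. (\<lambda>n. taylor_coeff f (n + 2) * z ^ (n + 2)) sums (f z - z))}"

definition schwarz_function :: "(complex \<Rightarrow> complex) \<Rightarrow> bool" where
  "schwarz_function w \<longleftrightarrow> w holomorphic_on unit_disc \<and> w 0 = 0 \<and>
     (\<forall>z\<in>unit_disc. norm (w z) \<le> norm z)"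

definition subordinate :: "(complex \<Rightarrow> complex) \<Rightarrow> (complex \<Rightarrow> complex) \<Rightarrow> bool" where
  "subordinate h g \<longleftrightarrow> h holomorphic_on unit_disc \<and> g holomorphic_on unit_disc \<and>
     (\<exists>w. schwarz_function w \<and> (\<forall>z\<in>unit_disc. h z = g (w z)))"

(* z f'(z) / f(z) for f in class_A has a removable singularity at 0, where its value is 1;
   HOL's 0 / 0 = 0 would give the wrong value there. *)
definition log_deriv_quotient :: "(complex \<Rightarrow> complex) \<Rightarrow> complex \<Rightarrow> complex" where
  "log_deriv_quotient f z = (if z = 0 then 1 else z * deriv f z / f z)"

(* For |z| < 1, 1 + tanh z = 2 / (1 + exp (-2 z)) avoids the nonpositive real axis
   (since |Im (2 z)| < pi), so the principal root csqrt is the analytic branch with value 1 at 0. *)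
definition bean_function :: "complex \<Rightarrow> complex" where
  "bean_function z = csqrt (1 + tanh z)"

(* The nonvanishing of f off 0 makes z f'(z) / f(z) a genuine quotient on the whole disc,
   with no appeal to HOL's x / 0 = 0. *)
definition class_SB :: "(complex \<Rightarrow> complex) set" where
  "class_SB = {f \<in> class_A. (\<forall>z\<in>unit_disc - {0}. f z \<noteq> 0) \<and>
     subordinate (log_deriv_quotient f) bean_function}"

definition hankel_2_3 :: "(complex \<Rightarrow> complex) \<Rightarrow> complex" where
  "hankel_2_3 f = taylor_coeff f 3 * taylor_coeff f 5 - (taylor_coeff f 4)\<^sup>2"

end

theory Submission
  imports Defs
begin

text \<open>
  Write the Schwarz function as \<open>w(z) = c\<^sub>1 z + c\<^sub>2 z\<^sup>2 + \<dots>\<close>. Comparing coefficients in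
  \<open>z f' = f \<phi>(w)\<close>, where \<open>\<phi>(w)\<^sup>2 = 1 + tanh w\<close>, expresses \<open>H_2(3)\<close> as a polynomial in \<open>c\<^sub>1, \<dots>, c\<^sub>4\<close>.
  Four steps of the Schur algorithm parametrise these coefficients by four points \<open>c, x, y, z\<close> of the
  closed unit disc. The plain triangle inequality then loses nothing that matters: it bounds
  \<open>|H_2(3)|\<close> by a quadratic in \<open>|y|\<close> whose coefficients are polynomials in \<open>|c|\<close> and \<open>|x|\<close>, and it
  suffices to bound two polynomials on the unit square. Equality holds for \<open>w(z) = z\<^sup>3\<close>.
\<close>

section \<open>Two polynomial inequalities on the unit square\<close>

text \<open>
  With \<open>c\<close>, \<open>x\<close>, \<open>y\<close> standing for the moduli of the first three Schur parameters, \<open>165888 * |H_2(3)|\<close>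
  is at most \<open>maj0 + maj1 * y + maj2 * y\<^sup>2 + maj3 * (1 - y\<^sup>2)\<close>; the factor \<open>165888 = 2 * 288\<^sup>2\<close> clears
  all denominators and turns \<open>1 / 36\<close> into \<open>4608\<close>.
\<close>

definition maj_M :: "real \<Rightarrow> real \<Rightarrow> real" where
  "maj_M c x = 48 * (1 - c^2) * x^2 + 12 * (1 - c^2) * x + 13 * c^2"

definition maj0 :: "real \<Rightarrow> real \<Rightarrow> real" where
  "maj0 c x = 9 * (4 * (1 - c^2) * x + c^2) * c^2 *
      (144 * (1 - c^2) * x^3 + 24 * (1 - c^2) * x^2 + 120 * (1 - c^2) * x + 11 * c^2)
    + 2 * c^2 * (maj_M c x)^2"

definition maj1 :: "real \<Rightarrow> real \<Rightarrow> real" where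
  "maj1 c x = c * (1 - c^2) * (1 - x^2) *
      (216 * (4 * (1 - c^2) * x + c^2) * (12 * x + 1) + 192 * maj_M c x)"

definition maj2 :: "real \<Rightarrow> real \<Rightarrow> real" where
  "maj2 c x = 1296 * (4 * (1 - c^2) * x + c^2) * (1 - c^2) * (1 - x^2) * x
    + 4608 * ((1 - c^2) * (1 - x^2))^2"

definition maj3 :: "real \<Rightarrow> real \<Rightarrow> real" where
  "maj3 c x = 1296 * (4 * (1 - c^2) * x + c^2) * (1 - c^2) * (1 - x^2)"

text \<open>
  Each box carries a certificate in the Bernstein basis of degree \<open>6\<close> in \<open>c\<close> and \<open>4\<close> in \<open>x\<close>. For
  \<open>maj2\<close> equality holds at \<open>c = x = 0\<close>, where the mixed term \<open>c * x\<close> of the deficit is negative; for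
  \<open>c \<le> 1 / 2\<close> the multiple of \<open>(2 * x - 3 * c)\<^sup>2\<close> split off absorbs it.
\<close>

lemma maj2_box1:
  assumes "0 \<le> c" "c \<le> 1 / 2" "0 \<le> x" "x \<le> 1 / 2"
  shows "maj0 c x + maj1 c x + maj2 c x \<le> 4608"
proof -
  \<comment> \<open>Affine coordinates of the box: \<open>u + v = 1\<close> and
    \<open>s + t = 1\<close>, and all four are nonnegative on it. Every product of their powers is
    then nonnegative, so a form in them with nonnegative coefficients is too.\<close>
  define u v s t where "u = 2 * c" "v = 1 - 2 * c" "s = 2 * x" "t = 1 - 2 * x"
  note uvst = this
  have nonneg: "0 \<le> u" "0 \<le> v" "0 \<le> s" "0 \<le> t"
    using assms by (simp_all add: uvst)
  have bernstein: "64 * (4608 - (maj0 c x + maj1 c x + maj2 c x)) =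
      v^6 * (27648 * s^2 * t^2 + 55296 * s^3 * t + 29952 * s^4)
      + u * v^5 * (59904 * s * t^3 + 188928 * s^2 * t^2 + 210816 * s^3 * t + 134784 * s^4)
      + u^2 * v^4 * (64512 * t^4 + 547200 * s * t^3 + 835200 * s^2 * t^2 + 346464 * s^3 * t + 213408 * s^4)
      + u^3 * v^3 * (236352 * t^4 + 1517952 * s * t^3 + 2002992 * s^2 * t^2 + 505536 * s^3 * t + 158544 * s^4)
      + u^4 * v^2 * (303552 * t^4 + 1794360 * s * t^3 + 2367456 * s^2 * t^2 + 660936 * s^3 * t + 91152 * s^4)
      + u^5 * v * (161520 * t^4 + 945264 * s * t^3 + 1307652 * s^2 * t^2 + 466632 * s^3 * t + 62388 * s^4)
      + u^6 * (29371 * t^4 + 180862 * s * t^3 + 269322 * s^2 * t^2 + 120508 * s^3 * t + 20497 * s^4)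
      + 36864 * (2 * x - 3 * c)^2"
    unfolding maj0_def maj1_def maj2_def maj_M_def uvst by (simp add: algebra_simps power_numeral_reduce)
  have "0 \<le> 64 * (4608 - (maj0 c x + maj1 c x + maj2 c x))"
    unfolding bernstein by (intro add_nonneg_nonneg mult_nonneg_nonneg; simp add: nonneg)
  then show ?thesis
    by simp
qed

lemma maj2_box2:
  assumes "0 \<le> c" "c \<le> 1 / 2" "1 / 2 \<le> x" "x \<le> 1"
  shows "maj0 c x + maj1 c x + maj2 c x \<le> 4608"
proof -
  define u v s t where "u = 2 * c" "v = 1 - 2 * c" "s = 2 * x - 1" "t = 2 - 2 * x"
  note uvst = this
  have nonneg: "0 \<le> u" "0 \<le> v" "0 \<le> s" "0 \<le> t"
    using assms by (simp_all add: uvst)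
  have bernstein: "64 * (4608 - (maj0 c x + maj1 c x + maj2 c x)) =
      v^6 * (29952 * t^4 + 184320 * s * t^3 + 414720 * s^2 * t^2 + 405504 * s^3 * t + 147456 * s^4)
      + u * v^5 * (134784 * t^4 + 867456 * s * t^3 + 2158848 * s^2 * t^2 + 2479104 * s^3 * t + 1105920 * s^4)
      + u^2 * v^4 * (213408 * t^4 + 1360800 * s * t^3 + 3878208 * s^2 * t^2 + 5465088 * s^3 * t + 2953728 * s^4)
      + u^3 * v^3 * (158544 * t^4 + 762816 * s * t^3 + 2774832 * s^2 * t^2 + 5500992 * s^3 * t + 3704832 * s^4)
      + u^4 * v^2 * (91152 * t^4 + 68280 * s * t^3 + 589488 * s^2 * t^2 + 2661096 * s^3 * t + 2355600 * s^4)
      + u^5 * v * (62388 * t^4 + 32472 * s * t^3 + 5172 * s^2 * t^2 + 682176 * s^3 * t + 766752 * s^4)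
      + u^6 * (20497 * t^4 + 43468 * s * t^3 + 38202 * s^2 * t^2 + 106234 * s^3 * t + 108823 * s^4)
      + 36864 * (2 * x - 3 * c)^2"
    unfolding maj0_def maj1_def maj2_def maj_M_def uvst by (simp add: algebra_simps power_numeral_reduce)
  have "0 \<le> 64 * (4608 - (maj0 c x + maj1 c x + maj2 c x))"
    unfolding bernstein by (intro add_nonneg_nonneg mult_nonneg_nonneg; simp add: nonneg)
  then show ?thesis
    by simp
qed

text \<open>The equality point \<open>c = x = 0\<close> lies outside the boxes with
  \<open>c \<ge> 1 / 2\<close>; on them the Bernstein coefficients are positive without any square
  being split off.\<close>

lemma maj2_box3:
  assumes "1 / 2 \<le> c" "c \<le> 1" "0 \<le> x" "x \<le> 1 / 2"
  shows "maj0 c x + maj1 c x + maj2 c x \<le> 4608"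
proof -
  define u v s t where "u = 2 * c - 1" "v = 2 - 2 * c" "s = 2 * x" "t = 1 - 2 * x"
  note uvst = this
  have nonneg: "0 \<le> u" "0 \<le> v" "0 \<le> s" "0 \<le> t"
    using assms by (simp_all add: uvst)
  have bernstein: "64 * (4608 - (maj0 c x + maj1 c x + maj2 c x)) =
      v^6 * (112315 * t^4 + 402046 * s * t^3 + 472074 * s^2 * t^2 + 194236 * s^3 * t + 29713 * s^4)
      + u * v^5 * (854484 * t^4 + 3105144 * s * t^3 + 3804276 * s^2 * t^2 + 1753608 * s^3 * t + 294168 * s^4)
      + u^2 * v^4 * (2607156 * t^4 + 9607776 * s * t^3 + 12306960 * s^2 * t^2 + 6321672 * s^3 * t + 1194756 * s^4)
      + u^3 * v^3 * (4080160 * t^4 + 15244672 * s * t^3 + 20403312 * s^2 * t^2 + 11517376 * s^3 * t + 2423728 * s^4)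
      + u^4 * v^2 * (3459792 * t^4 + 13127904 * s * t^3 + 18324096 * s^2 * t^2 + 11181408 * s^3 * t + 2566896 * s^4)
      + u^5 * v * (1512000 * t^4 + 5856384 * s * t^3 + 8497152 * s^2 * t^2 + 5493888 * s^3 * t + 1341120 * s^4)
      + u^6 * (266944 * t^4 + 1067776 * s * t^3 + 1601664 * s^2 * t^2 + 1067776 * s^3 * t + 266944 * s^4)"
    unfolding maj0_def maj1_def maj2_def maj_M_def uvst by (simp add: algebra_simps power_numeral_reduce)
  have "0 \<le> 64 * (4608 - (maj0 c x + maj1 c x + maj2 c x))"
    unfolding bernstein by (intro add_nonneg_nonneg mult_nonneg_nonneg; simp add: nonneg)
  then show ?thesis
    by simp
qed

lemma maj2_box4:
  assumes "1 / 2 \<le> c" "c \<le> 1" "1 / 2 \<le> x" "x \<le> 1"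
  shows "maj0 c x + maj1 c x + maj2 c x \<le> 4608"
proof -
  define u v s t where "u = 2 * c - 1" "v = 2 - 2 * c" "s = 2 * x - 1" "t = 2 - 2 * x"
  note uvst = this
  have nonneg: "0 \<le> u" "0 \<le> v" "0 \<le> s" "0 \<le> t"
    using assms by (simp_all add: uvst)
  have bernstein: "64 * (4608 - (maj0 c x + maj1 c x + maj2 c x)) =
      v^6 * (29713 * t^4 + 43468 * s * t^3 + 19770 * s^2 * t^2 + 106234 * s^3 * t + 118039 * s^4)
      + u * v^5 * (294168 * t^4 + 599736 * s * t^3 + 342660 * s^2 * t^2 + 482040 * s^3 * t + 539124 * s^4)
      + u^2 * v^4 * (1194756 * t^4 + 3236376 * s * t^3 + 3051072 * s^2 * t^2 + 1992192 * s^3 * t + 1162164 * s^4)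
      + u^3 * v^3 * (2423728 * t^4 + 7872448 * s * t^3 + 9468528 * s^2 * t^2 + 5719360 * s^3 * t + 1844704 * s^4)
      + u^4 * v^2 * (2566896 * t^4 + 9353760 * s * t^3 + 12841152 * s^2 * t^2 + 8132256 * s^3 * t + 2119440 * s^4)
      + u^5 * v * (1341120 * t^4 + 5235072 * s * t^3 + 7720704 * s^2 * t^2 + 5121408 * s^3 * t + 1294656 * s^4)
      + u^6 * (266944 * t^4 + 1067776 * s * t^3 + 1601664 * s^2 * t^2 + 1067776 * s^3 * t + 266944 * s^4)"
    unfolding maj0_def maj1_def maj2_def maj_M_def uvst by (simp add: algebra_simps power_numeral_reduce)
  have "0 \<le> 64 * (4608 - (maj0 c x + maj1 c x + maj2 c x))"
    unfolding bernstein by (intro add_nonneg_nonneg mult_nonneg_nonneg; simp add: nonneg)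
  then show ?thesis
    by simp
qed

text \<open>The factor \<open>4 * (1 - c^2) * x + c^2\<close> makes \<open>maj3\<close> vanish at
  \<open>c = x = 0\<close>, so here the deficit stays strictly positive on the whole square. The
  certificates have positive coefficients only, and a single box covers
  \<open>x \<le> 1 / 2\<close>.\<close>

lemma maj3_box1:
  assumes "0 \<le> c" "c \<le> 1" "0 \<le> x" "x \<le> 1 / 2"
  shows "maj0 c x + maj1 c x + maj3 c x \<le> 4608"
proof -
  define u v s t where "u = c" "v = 1 - c" "s = 2 * x" "t = 1 - 2 * x"
  note uvst = this
  have nonneg: "0 \<le> u" "0 \<le> v" "0 \<le> s" "0 \<le> t"
    using assms by (simp_all add: uvst)
  have bernstein: "(4608 - (maj0 c x + maj1 c x + maj3 c x)) =
      v^6 * (4608 * t^4 + 15840 * s * t^3 + 19872 * s^2 * t^2 + 11304 * s^3 * t + 2664 * s^4)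
      + u * v^5 * (27648 * t^4 + 93456 * s * t^3 + 109584 * s^2 * t^2 + 53676 * s^3 * t + 11124 * s^4)
      + u^2 * v^4 * (67824 * t^4 + 229680 * s * t^3 + 256788 * s^2 * t^2 + 105840 * s^3 * t + 16416 * s^4)
      + u^3 * v^3 * (84264 * t^4 + 291984 * s * t^3 + 328566 * s^2 * t^2 + 127920 * s^3 * t + 14418 * s^4)
      + u^4 * v^2 * (54504 * t^4 + 196374 * s * t^3 + 240882 * s^2 * t^2 + 114060 * s^3 * t + 17496 * s^4)
      + u^5 * v * (19632 * t^4 + 73836 * s * t^3 + 104364 * s^2 * t^2 + 66072 * s^3 * t + 15912 * s^4)
      + u^6 * (4171 * t^4 + 16684 * s * t^3 + 25026 * s^2 * t^2 + 16684 * s^3 * t + 4171 * s^4)"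
    unfolding maj0_def maj1_def maj3_def maj_M_def uvst by (simp add: algebra_simps power_numeral_reduce)
  have "0 \<le> (4608 - (maj0 c x + maj1 c x + maj3 c x))"
    unfolding bernstein by (intro add_nonneg_nonneg mult_nonneg_nonneg; simp add: nonneg)
  then show ?thesis
    by simp
qed

lemma maj3_box2:
  assumes "0 \<le> c" "c \<le> 1 / 2" "1 / 2 \<le> x" "x \<le> 1"
  shows "maj0 c x + maj1 c x + maj3 c x \<le> 4608"
proof -
  define u v s t where "u = 2 * c" "v = 1 - 2 * c" "s = 2 * x - 1" "t = 2 - 2 * x"
  note uvst = this
  have nonneg: "0 \<le> u" "0 \<le> v" "0 \<le> s" "0 \<le> t"
    using assms by (simp_all add: uvst)
  have bernstein: "64 * (4608 - (maj0 c x + maj1 c x + maj3 c x)) =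
      v^6 * (170496 * t^4 + 640512 * s * t^3 + 1022976 * s^2 * t^2 + 847872 * s^3 * t + 294912 * s^4)
      + u * v^5 * (867456 * t^4 + 3051648 * s * t^3 + 4813056 * s^2 * t^2 + 4359168 * s^3 * t + 1769472 * s^4)
      + u^2 * v^4 * (1791936 * t^4 + 5635008 * s * t^3 + 8448192 * s^2 * t^2 + 8561664 * s^3 * t + 4142592 * s^4)
      + u^3 * v^3 * (1956816 * t^4 + 5141568 * s * t^3 + 6677808 * s^2 * t^2 + 7934016 * s^3 * t + 4773888 * s^4)
      + u^4 * v^2 * (1241784 * t^4 + 2577552 * s * t^3 + 2307408 * s^2 * t^2 + 3545832 * s^3 * t + 2853264 * s^4)
      + u^5 * v * (462852 * t^4 + 827784 * s * t^3 + 390516 * s^2 * t^2 + 792768 * s^3 * t + 877344 * s^4)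
      + u^6 * (82201 * t^4 + 162052 * s * t^3 + 84570 * s^2 * t^2 + 106234 * s^3 * t + 118039 * s^4)"
    unfolding maj0_def maj1_def maj3_def maj_M_def uvst by (simp add: algebra_simps power_numeral_reduce)
  have "0 \<le> 64 * (4608 - (maj0 c x + maj1 c x + maj3 c x))"
    unfolding bernstein by (intro add_nonneg_nonneg mult_nonneg_nonneg; simp add: nonneg)
  then show ?thesis
    by simp
qed

lemma maj3_box3:
  assumes "1 / 2 \<le> c" "c \<le> 1" "1 / 2 \<le> x" "x \<le> 1"
  shows "maj0 c x + maj1 c x + maj3 c x \<le> 4608"
proof -
  define u v s t where "u = 2 * c - 1" "v = 2 - 2 * c" "s = 2 * x - 1" "t = 2 - 2 * x"
  note uvst = this
  have nonneg: "0 \<le> u" "0 \<le> v" "0 \<le> s" "0 \<le> t"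
    using assms by (simp_all add: uvst)
  have bernstein: "64 * (4608 - (maj0 c x + maj1 c x + maj3 c x)) =
      v^6 * (82201 * t^4 + 162052 * s * t^3 + 84570 * s^2 * t^2 + 106234 * s^3 * t + 118039 * s^4)
      + u * v^5 * (523560 * t^4 + 1116840 * s * t^3 + 624324 * s^2 * t^2 + 482040 * s^3 * t + 539124 * s^4)
      + u^2 * v^4 * (1545324 * t^4 + 4022832 * s * t^3 + 3476448 * s^2 * t^2 + 1992192 * s^3 * t + 1162164 * s^4)
      + u^3 * v^3 * (2615536 * t^4 + 8295808 * s * t^3 + 9692016 * s^2 * t^2 + 5719360 * s^3 * t + 1844704 * s^4)
      + u^4 * v^2 * (2553936 * t^4 + 9316608 * s * t^3 + 12814656 * s^2 * t^2 + 8132256 * s^3 * t + 2119440 * s^4)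
      + u^5 * v * (1310016 * t^4 + 5162496 * s * t^3 + 7679232 * s^2 * t^2 + 5121408 * s^3 * t + 1294656 * s^4)
      + u^6 * (266944 * t^4 + 1067776 * s * t^3 + 1601664 * s^2 * t^2 + 1067776 * s^3 * t + 266944 * s^4)"
    unfolding maj0_def maj1_def maj3_def maj_M_def uvst by (simp add: algebra_simps power_numeral_reduce)
  have "0 \<le> 64 * (4608 - (maj0 c x + maj1 c x + maj3 c x))"
    unfolding bernstein by (intro add_nonneg_nonneg mult_nonneg_nonneg; simp add: nonneg)
  then show ?thesis
    by simp
qed

lemma maj_sum2_le:
  assumes "0 \<le> c" "c \<le> 1" "0 \<le> x" "x \<le> 1"
  shows "maj0 c x + maj1 c x + maj2 c x \<le> 4608"
  using maj2_box1[of c x] maj2_box2[of c x] maj2_box3[of c x] maj2_box4[of c x] assms by linarith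

lemma maj_sum3_le:
  assumes "0 \<le> c" "c \<le> 1" "0 \<le> x" "x \<le> 1"
  shows "maj0 c x + maj1 c x + maj3 c x \<le> 4608"
  using maj3_box1[of c x] maj3_box2[of c x] maj3_box3[of c x] assms by linarith

section \<open>The Hankel determinant in terms of Schur parameters\<close>

text \<open>With \<open>c\<close>, \<open>x\<close>, \<open>y\<close>, \<open>z\<close> the Schur
  parameters, the Schwarz function has coefficients \<open>c\<close>, \<open>c2\<close>,
  \<open>c3\<close>, \<open>c4\<close>, and the expression inside the norm is \<open>H_2(3)\<close>.
  Expanding it into monomials and taking moduli term by term leaves a majorant in the moduli of
  \<open>c\<close>, \<open>x\<close>, \<open>y\<close> alone.\<close>

lemma hankel_schur_bound:
  fixes c x y z c2 c3 c4 :: complex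
  assumes norms: "norm c \<le> 1" "norm x \<le> 1" "norm y \<le> 1" "norm z \<le> 1"
    and q: "q = 1 - (norm c)^2" and r: "r = 1 - (norm x)^2" and p: "p = 1 - (norm y)^2"
    and c2: "c2 = q * x"
    and c3: "c3 = q * (r * y - cnj c * x^2)"
    and c4: "c4 = q * (r * p * z - r * cnj x * y^2 - 2 * cnj c * r * x * y + (cnj c)^2 * x^3)"
  shows "norm ((4 * c2 + c^2) / 16 * ((144 * c4 + 24 * c * c3 - 120 * c^2 * c2 - 11 * c^4) / 1152)
      - ((48 * c3 + 12 * c * c2 - 13 * c^3) / 288)^2) \<le> 1 / 36"
proof -
  define C X Y where "C = norm c" "X = norm x" "Y = norm y"
  note CXY = this
  have C: "0 \<le> C" "C \<le> 1" and X: "0 \<le> X" "X \<le> 1" and Y: "0 \<le> Y" "Y \<le> 1"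
    using norms by (auto simp: CXY)
  have q': "q = 1 - C^2" and r': "r = 1 - X^2" and p': "p = 1 - Y^2"
    using q r p by (auto simp: CXY)
  have q0: "0 \<le> q" and r0: "0 \<le> r" and p0: "0 \<le> p"
    using C X Y by (auto simp: q' r' p' power_le_one)
  define \<alpha> where "\<alpha> = 4 * q * X + C^2"
  define M where "M = 48 * q * X^2 + 12 * q * X + 13 * C^2"
  have \<alpha>0: "0 \<le> \<alpha>" and M0: "0 \<le> M"
    using q0 X by (auto simp: \<alpha>_def M_def)
  \<comment> \<open>Numerators over a common denominator: 165888 is both 9 * 16 * 1152 and 2 *
    288^2, so the expression equals \<open>(9 * (A * B) - 2 * N^2) / 165888\<close>.\<close>
  define A where "A = 4 * c2 + c^2"
  define B where "B = 144 * c4 + 24 * c * c3 - 120 * c^2 * c2 - 11 * c^4"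
  define N where "N = 48 * c3 + 12 * c * c2 - 13 * c^3"
  have "norm A \<le> norm (4 * c2) + norm (c^2)"
    unfolding A_def by (rule norm_triangle_ineq)
  also have "\<dots> = \<alpha>"
    using q0 by (simp add: \<alpha>_def c2 CXY norm_mult norm_power)
  finally have A: "norm A \<le> \<alpha>" .
  have cc: "c * cnj c = of_real (C^2)"
    by (simp only: CXY complex_norm_square)
  \<comment> \<open>Subtracted monomials are written as added negations, so that iterating the
    triangle inequality for sums bounds each one separately. The product \<open>c * cnj c\<close>
    has become the real number \<open>C^2\<close>.\<close>
  have B_eq: "B = 144 * q * r * p * z + (- (144 * q * r * cnj x * y^2)) + (- (288 * q * r * cnj c * x * y))
      + 24 * c * q * r * y + 144 * q * (cnj c)^2 * x^3 + (- (24 * q * C^2 * x^2))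
      + (- (120 * c^2 * q * x)) + (- (11 * c^4))"
    unfolding B_def c2 c3 c4 of_real_mult of_real_numeral cc[symmetric] by algebra
  have "norm B \<le> 144 * q * r * p * norm z + 144 * q * r * X * Y^2 + 288 * q * r * C * X * Y
      + 24 * C * q * r * Y + 144 * q * C^2 * X^3 + 24 * q * C^2 * X^2 + 120 * C^2 * q * X + 11 * C^4"
    unfolding B_eq
    by (intro norm_triangle_mono) (use q0 r0 p0 in \<open>simp_all add: CXY norm_mult norm_power\<close>)
  also have "\<dots> \<le> 144 * q * r * p * 1 + 144 * q * r * X * Y^2 + 288 * q * r * C * X * Y
      + 24 * C * q * r * Y + 144 * q * C^2 * X^3 + 24 * q * C^2 * X^2 + 120 * C^2 * q * X + 11 * C^4"
    using q0 r0 p0 norms(4) by (intro add_right_mono mult_left_mono) auto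
  finally have B: "norm B \<le> \<dots>" .
  have N_eq: "N = 48 * q * r * y + (- (48 * q * cnj c * x^2)) + 12 * c * q * x + (- (13 * c^3))"
    unfolding N_def c2 c3 of_real_mult of_real_numeral by algebra
  have "norm N \<le> 48 * q * r * Y + 48 * q * C * X^2 + 12 * C * q * X + 13 * C^3"
    unfolding N_eq
    by (intro norm_triangle_mono) (use q0 r0 p0 in \<open>simp_all add: CXY norm_mult norm_power\<close>)
  also have "\<dots> = 48 * q * r * Y + C * M"
    unfolding M_def by algebra
  finally have N: "norm N \<le> 48 * q * r * Y + C * M" .
  have "norm (9 * (A * B) - 2 * N^2) \<le> 9 * (norm A * norm B) + 2 * (norm N)^2"
    by (rule order_trans[OF norm_triangle_ineq4]) (simp add: norm_mult norm_power)
  also have "\<dots> \<le> 9 * (\<alpha> * (144 * q * r * p * 1 + 144 * q * r * X * Y^2 + 288 * q * r * C * X * Y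
      + 24 * C * q * r * Y + 144 * q * C^2 * X^3 + 24 * q * C^2 * X^2 + 120 * C^2 * q * X + 11 * C^4))
      + 2 * (48 * q * r * Y + C * M)^2"
    using A B N \<alpha>0 by (intro add_mono mult_left_mono mult_mono power_mono) auto
  also have "\<dots> = maj0 C X + maj1 C X * Y + maj2 C X * Y^2 + maj3 C X * (1 - Y^2)"
    unfolding maj0_def maj1_def maj2_def maj3_def maj_M_def \<alpha>_def M_def q' r' p' by algebra
  \<comment> \<open>Replacing \<open>Y\<close> by 1 in the linear term only leaves a convex
    combination, with weights \<open>Y^2\<close> and \<open>1 - Y^2\<close>, of the two sums already
    bounded by 4608.\<close>
  also have "\<dots> \<le> maj0 C X + maj1 C X + maj2 C X * Y^2 + maj3 C X * (1 - Y^2)"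
  proof -
    have "0 \<le> maj1 C X"
      unfolding maj1_def maj_M_def using C X q0 r0 by (simp add: q' r')
    then show ?thesis
      using Y by (simp add: mult_left_le)
  qed
  also have "\<dots> = (maj0 C X + maj1 C X + maj2 C X) * Y^2 + (maj0 C X + maj1 C X + maj3 C X) * (1 - Y^2)"
    by algebra
  also have "\<dots> \<le> 4608 * Y^2 + 4608 * (1 - Y^2)"
    using C X p0 by (intro add_mono mult_right_mono maj_sum2_le maj_sum3_le) (auto simp: p')
  finally have "norm (9 * (A * B) - 2 * N^2) \<le> 4608"
    by simp
  then have "norm ((9 * (A * B) - 2 * N^2) / 165888) \<le> 1 / 36"
    by (simp add: norm_divide)
  moreover have "(9 * (A * B) - 2 * N^2) / 165888 = A / 16 * (B / 1152) - (N / 288)^2"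
    by (simp add: field_simps power2_eq_square)
  ultimately show ?thesis
    by (simp only: A_def B_def N_def)
qed

section \<open>The Schur algorithm\<close>

definition schur_class :: "(complex \<Rightarrow> complex) set" where
  "schur_class = {s. s holomorphic_on unit_disc \<and> (\<forall>z\<in>unit_disc. norm (s z) \<le> 1)}"

text \<open>With \<open>a = s 0\<close> of modulus below 1, the Moebius map sending \<open>a\<close>
  to 0 turns \<open>s\<close> into a self-map of the disc that fixes 0, and the Schwarz lemma lets a
  factor \<open>z\<close> be divided out. The relation is stated without division so that it passes
  directly to power series.\<close>

lemma schur_step:
  assumes s: "s \<in> schur_class"
  obtains t where "t \<in> schur_class"
    "\<And>z. z \<in> unit_disc \<Longrightarrow> s z * (1 + cnj (s 0) * (z * t z)) = s 0 + z * t z"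
proof -
  define a where "a = s 0"
  have hol: "s holomorphic_on unit_disc" and le1: "\<And>z. z \<in> unit_disc \<Longrightarrow> norm (s z) \<le> 1"
    using s by (auto simp: schur_class_def)
  \<comment> \<open>Attaining modulus 1 anywhere in the disc makes \<open>s\<close> constant. This
    settles the case of \<open>a\<close> on the unit circle, where \<open>t = 0\<close> serves, and
    otherwise gives the strict bound that the Moebius map requires.\<close>
  have const: "s z = a" if "\<xi> \<in> unit_disc" "norm (s \<xi>) = 1" "z \<in> unit_disc" for \<xi> z
  proof -
    have "s constant_on unit_disc"
      by (rule maximum_modulus_principle[OF hol, where U = unit_disc and \<xi> = \<xi>])
        (use that le1 in auto)
    then show ?thesis
      using that(3) by (auto simp: constant_on_def a_def)
  qed
  show ?thesis
  proof (cases "norm a = 1")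
    case True
    show ?thesis
    proof (rule that[of "\<lambda>_. 0"])
      fix z :: complex
      assume z: "z \<in> unit_disc"
      have "s z = s 0"
        using const[of 0 z] True z unfolding a_def by simp
      then show "s z * (1 + cnj (s 0) * (z * 0)) = s 0 + z * 0"
        by simp
    qed (simp add: schur_class_def)
  next
    case False
    then have a: "norm a < 1"
      using le1[of 0] by (simp add: a_def)
    have lt1: "norm (s z) < 1" if "z \<in> unit_disc" for z
      using const[of z z] le1[of z] that a False by fastforce
    define m where "m = (\<lambda>z. Moebius_function 0 a (s z))"
    have m_hol: "m holomorphic_on unit_disc"
      unfolding m_def
      by (rule holomorphic_on_compose_gen[OF hol Moebius_function_holomorphic[OF a], unfolded o_def])
        (use lt1 in auto)
    have m0: "m 0 = 0"
      by (simp add: m_def a_def Moebius_function_simple)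
    have m_lt: "norm (m z) < 1" if "norm z < 1" for z
      unfolding m_def using lt1 that by (intro Moebius_function_norm_lt_1 a) auto
    obtain t where t: "t holomorphic_on unit_disc" "\<And>z. norm z < 1 \<Longrightarrow> m z = z * t z" "deriv m 0 = t 0"
      using Schwarz3[OF m_hol m0] by blast
    have "norm (t z) \<le> 1" if z: "z \<in> unit_disc" for z
    \<comment> \<open>Off the origin the bound comes from dividing \<open>m z = z * t z\<close> by
      \<open>z\<close>; at the origin \<open>t 0\<close> is \<open>deriv m 0\<close>, bounded by the
      derivative part of the Schwarz lemma.\<close>
    proof (cases "z = 0")
      case True
      then show ?thesis
        using Schwarz_Lemma(2)[OF m_hol m0 m_lt, of 0] t(3) by simp
    next
      case False
      then show ?thesis
        using Schwarz_Lemma(1)[OF m_hol m0 m_lt, of z] t(2)[of z] z by (simp add: norm_mult)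
    qed
    then have "t \<in> schur_class"
      using t(1) by (simp add: schur_class_def)
    moreover have "s z * (1 + cnj (s 0) * (z * t z)) = s 0 + z * t z" if z: "z \<in> unit_disc" for z
    proof -
      have "norm (cnj a * s z) < 1"
        using norm_mult_less[of "cnj a" 1 "s z" 1] a lt1[OF z] by simp
      then have "1 - cnj a * s z \<noteq> 0"
        by auto
      moreover have "z * t z = (s z - a) / (1 - cnj a * s z)"
        using t(2)[of z] z by (simp add: m_def Moebius_function_simple)
      ultimately have "z * t z * (1 - cnj a * s z) = s z - a"
        by (simp add: field_simps)
      then show ?thesis
        unfolding a_def by algebra
    qed
    ultimately show ?thesis
      by (rule that)
  qed
qed

section \<open>From identities on the disc to identities of formal power series\<close>

lemma disc_has_fps_expansion:
  "f holomorphic_on unit_disc \<Longrightarrow> f has_fps_expansion fps_expansion f 0"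
  by (rule has_fps_expansion_fps_expansion[of unit_disc]) auto

lemma fps_eq_of_eq_on_disc:
  assumes "f has_fps_expansion F" "g has_fps_expansion G" "\<And>z. z \<in> unit_disc \<Longrightarrow> f z = g z"
  shows "F = G"
proof -
  have "eventually (\<lambda>z. z \<in> unit_disc) (nhds (0::complex))"
    by (rule eventually_nhds_in_open) auto
  then have "eventually (\<lambda>z. f z = g z) (nhds 0)"
    by eventually_elim (rule assms(3))
  then show ?thesis
    using assms(1,2) has_fps_expansion_cong fps_expansion_unique_complex by metis
qed

lemma schur_step_fps:
  assumes s: "s \<in> schur_class"
  obtains t where "t \<in> schur_class"
    "fps_expansion s 0 * (1 + fps_const (cnj (taylor_coeff s 0)) * (fps_X * fps_expansion t 0))
      = fps_const (taylor_coeff s 0) + fps_X * fps_expansion t 0"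
proof -
  obtain t where t: "t \<in> schur_class"
    "\<And>z. z \<in> unit_disc \<Longrightarrow> s z * (1 + cnj (s 0) * (z * t z)) = s 0 + z * t z"
    using schur_step[OF s] by blast
  have s0: "taylor_coeff s 0 = s 0"
    by (simp add: taylor_coeff_def fps_expansion_def)
  have S: "s has_fps_expansion fps_expansion s 0" and T: "t has_fps_expansion fps_expansion t 0"
    using s t(1) by (auto simp: schur_class_def intro: disc_has_fps_expansion)
  have "fps_expansion s 0 * (1 + fps_const (cnj (s 0)) * (fps_X * fps_expansion t 0))
      = fps_const (s 0) + fps_X * fps_expansion t 0"
  proof (rule fps_eq_of_eq_on_disc[OF _ _ t(2)])
    show "(\<lambda>z. s z * (1 + cnj (s 0) * (z * t z))) has_fps_expansion
        fps_expansion s 0 * (1 + fps_const (cnj (s 0)) * (fps_X * fps_expansion t 0))"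
      by (intro fps_expansion_intros S T)
    show "(\<lambda>z. s 0 + z * t z) has_fps_expansion fps_const (s 0) + fps_X * fps_expansion t 0"
      by (intro fps_expansion_intros S T)
  qed
  then show ?thesis
    using that t(1) unfolding s0 by blast
qed

lemma taylor_coeff_0_schur: "s \<in> schur_class \<Longrightarrow> norm (taylor_coeff s 0) \<le> 1"
  by (simp add: schur_class_def taylor_coeff_def fps_expansion_def)

text \<open>The Schur relation reads \<open>S = a + X * (T - cnj a * T * S)\<close>, so each
  coefficient of \<open>S\<close> is determined by earlier ones of \<open>S\<close> and
  \<open>T\<close>. The factor \<open>1 - |a|^2\<close> arises where the constant term
  \<open>a\<close> of \<open>S\<close> meets the top coefficient of \<open>T\<close>.\<close>

lemma schur_coeffs:
  assumes s: "s \<in> schur_class"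
  obtains t where "t \<in> schur_class"
    "taylor_coeff s 1 = (1 - (norm (taylor_coeff s 0))^2) * taylor_coeff t 0"
    "taylor_coeff s 2 = (1 - (norm (taylor_coeff s 0))^2) * taylor_coeff t 1
       - cnj (taylor_coeff s 0) * taylor_coeff t 0 * taylor_coeff s 1"
    "taylor_coeff s 3 = (1 - (norm (taylor_coeff s 0))^2) * taylor_coeff t 2
       - cnj (taylor_coeff s 0) * (taylor_coeff t 0 * taylor_coeff s 2 + taylor_coeff t 1 * taylor_coeff s 1)"
proof -
  obtain t where t: "t \<in> schur_class"
    "fps_expansion s 0 * (1 + fps_const (cnj (taylor_coeff s 0)) * (fps_X * fps_expansion t 0))
      = fps_const (taylor_coeff s 0) + fps_X * fps_expansion t 0" (is "?L = ?R")
    using schur_step_fps[OF s] by blast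
  define S T a where "S = fps_expansion s 0" "T = fps_expansion t 0" "a = taylor_coeff s 0"
  note STa = this
  have a: "S $ 0 = a"
    by (simp add: STa taylor_coeff_def)
  have norm: "complex_of_real (1 - (norm a)^2) = 1 - a * cnj a"
    by (simp only: of_real_diff of_real_1 complex_norm_square)
  define U where "U = T - fps_const (cnj a) * (T * S)"
  have "S = fps_const a + fps_X * U"
    using t(2) unfolding STa U_def by (simp add: algebra_simps)
  then have S: "S $ Suc n = U $ n" for n
    by simp
  have coeffs: "taylor_coeff s n = S $ n" "taylor_coeff t n = T $ n" for n
    by (simp_all add: STa taylor_coeff_def)
  show ?thesis
  proof (rule that[OF t(1)]; unfold coeffs a norm)
    show "S $ 1 = (1 - a * cnj a) * T $ 0"
      using S[of 0] a by (simp add: U_def algebra_simps)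
    show "S $ 2 = (1 - a * cnj a) * T $ 1 - cnj a * T $ 0 * S $ 1"
      using S[of 1] a by (simp add: U_def fps_mult_nth numeral_2_eq_2 algebra_simps)
    show "S $ 3 = (1 - a * cnj a) * T $ 2 - cnj a * (T $ 0 * S $ 2 + T $ 1 * S $ 1)"
      using S[of 2] a by (simp add: U_def fps_mult_nth numeral_3_eq_3 numeral_2_eq_2 algebra_simps)
  qed
qed

section \<open>Coefficients of functions in the class\<close>

text \<open>The argument \<open>2 * Im z\<close> has modulus below 2, hence below pi, so
  \<open>exp (2 * z)\<close> stays off the branch cut. This keeps both \<open>cosh z\<close> away
  from 0 and \<open>1 + tanh z\<close> away from the cut.\<close>

lemma exp_double_not_nonpos:
  assumes z: "norm (z :: complex) < 1"
  shows "exp (2 * z) \<notin> \<real>\<^sub>\<le>\<^sub>0"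
proof
  assume nonpos: "exp (2 * z) \<in> \<real>\<^sub>\<le>\<^sub>0"
  define y where "y = 2 * Im z"
  have y: "\<bar>y\<bar> < pi"
    using abs_Im_le_cmod[of z] z pi_gt3 by (simp add: y_def)
  have "sin y = 0"
    using nonpos by (auto simp: complex_nonpos_Reals_iff Im_exp y_def)
  then have "y = 0"
    using y sin_eq_0_pi by auto
  then show False
    using nonpos by (auto simp: complex_nonpos_Reals_iff Re_exp y_def)
qed

lemma cosh_nonzero_disc:
  assumes z: "norm (z :: complex) < 1"
  shows "cosh z \<noteq> 0"
  using exp_double_not_nonpos[OF z] by (auto simp: cosh_zero_iff exp_double)

text \<open>With \<open>E = exp (2 * z)\<close> one has \<open>1 + tanh z = 2 * E / (E + 1)\<close>.
  Setting this equal to a real \<open>\<rho> \<le> 0\<close> and solving gives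
  \<open>E = \<rho> / (2 - \<rho>) \<le> 0\<close>, which is impossible.\<close>

lemma one_plus_tanh_not_nonpos:
  assumes z: "norm (z :: complex) < 1"
  shows "1 + tanh z \<notin> \<real>\<^sub>\<le>\<^sub>0"
proof
  define E where "E = exp (2 * z)"
  assume "1 + tanh z \<in> \<real>\<^sub>\<le>\<^sub>0"
  then obtain \<rho> where \<rho>: "\<rho> \<le> 0" "1 + tanh z = of_real \<rho>"
    by (auto elim!: nonpos_Reals_cases)
  have "1 + tanh z = (cosh z + sinh z) / cosh z"
    using cosh_nonzero_disc[OF z] by (simp add: tanh_def field_simps)
  then have "exp z = of_real \<rho> * cosh z"
    using cosh_nonzero_disc[OF z] \<rho>(2) by (simp add: cosh_plus_sinh)
  then have "2 * exp z = of_real \<rho> * (exp z + exp (- z))"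
    by (simp add: cosh_field_def mult.commute)
  moreover have E: "E = exp z * exp z" and "exp (- z) * exp z = 1"
    by (simp_all add: E_def exp_double power2_eq_square exp_minus)
  ultimately have "2 * E = of_real \<rho> * (E + 1)"
    by algebra
  then have "E * of_real (2 - \<rho>) = of_real \<rho>"
    by (simp add: algebra_simps)
  then have "E = of_real (\<rho> / (2 - \<rho>))"
    using \<rho>(1) by (simp add: field_simps flip: of_real_diff)
  moreover have "\<rho> / (2 - \<rho>) \<le> 0"
    using \<rho>(1) by (simp add: divide_nonpos_pos)
  ultimately have "E \<in> \<real>\<^sub>\<le>\<^sub>0"
    by (simp only: nonpos_Reals_of_real_iff)
  then show False
    using exp_double_not_nonpos[OF z] by (simp add: E_def)
qed

lemma tanh_holomorphic_disc: "tanh holomorphic_on unit_disc"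
proof (rule holomorphic_onI)
  fix z :: complex
  assume "z \<in> unit_disc"
  then have "(tanh has_field_derivative (1 - (tanh z)\<^sup>2) * 1) (at z)"
    by (intro has_field_derivative_tanh DERIV_ident cosh_nonzero_disc) simp
  then show "tanh field_differentiable at z within unit_disc"
    by (auto simp: field_differentiable_def intro: has_field_derivative_at_within)
qed

lemma bean_function_holomorphic: "bean_function holomorphic_on unit_disc"
proof -
  have "(\<lambda>z. csqrt (1 + tanh z)) holomorphic_on unit_disc"
    by (intro holomorphic_on_csqrt' holomorphic_intros tanh_holomorphic_disc)
      (simp add: one_plus_tanh_not_nonpos)
  then show ?thesis
    by (simp add: bean_function_def[abs_def])
qed

section \<open>Taylor coefficients of \<open>f\<close> in terms of those of the Schwarz
  function\<close>

lemma class_A_coeffs: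
  assumes f: "f \<in> class_A"
  shows "f 0 = 0" "taylor_coeff f 0 = 0" "taylor_coeff f 1 = 1"
proof -
  have hol: "f holomorphic_on unit_disc"
    and sums: "\<And>z. z \<in> unit_disc \<Longrightarrow> (\<lambda>n. taylor_coeff f (n + 2) * z ^ (n + 2)) sums (f z - z)"
    using f by (auto simp: class_A_def)
  have "(\<lambda>n. 0) sums (f 0)"
    using sums[of 0] by simp
  then show f0: "f 0 = 0"
    using sums_unique2 sums_zero by blast
  then show c0: "taylor_coeff f 0 = 0"
    by (simp add: taylor_coeff_def fps_expansion_def)
  \<comment> \<open>The full Taylor series and the series defining \<open>class_A\<close> share
    their tail from index 2. Comparing them at one nonzero point therefore determines the
    coefficient of index 1.\<close>
  have half: "(1 / 2 :: complex) \<in> unit_disc"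
    by (simp add: norm_divide)
  have "(\<lambda>n. taylor_coeff f n * (1 / 2) ^ n) sums f (1 / 2)"
    unfolding taylor_coeff_def
    by (rule has_fps_expansion_imp_sums_complex[OF disc_has_fps_expansion[OF hol], of 1])
      (use hol half in \<open>simp_all add: one_ereal_def\<close>)
  then have "(\<lambda>n. taylor_coeff f (n + 2) * (1 / 2) ^ (n + 2)) sums
      (f (1 / 2) - (\<Sum>i<2. taylor_coeff f i * (1 / 2) ^ i))"
    by (rule sums_split_initial_segment)
  then have "f (1 / 2) - (\<Sum>i<2. taylor_coeff f i * (1 / 2) ^ i) = f (1 / 2) - 1 / 2"
    using sums[OF half] sums_unique2 by blast
  then show "taylor_coeff f 1 = 1"
    using c0 by (simp add: eval_nat_numeral)
qed

text \<open>No series of tanh or of the square root is expanded. With \<open>\<tau>\<close> standing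
  for tanh of \<open>w\<close>, coefficients are compared in
  \<open>\<tau>' = (1 - \<tau>^2) * w'\<close>, \<open>h^2 = 1 + \<tau>\<close> and
  \<open>z * f' = f * h\<close>, each a recursion for the next unknown series.\<close>

lemma SB_coeffs:
  assumes f: "f \<in> class_A" "\<And>z. z \<in> unit_disc - {0} \<Longrightarrow> f z \<noteq> 0"
    and w: "schwarz_function w"
    and h: "log_deriv_quotient f holomorphic_on unit_disc"
    and sub: "\<And>z. z \<in> unit_disc \<Longrightarrow> log_deriv_quotient f z = bean_function (w z)"
  defines "c \<equiv> taylor_coeff w"
  shows "taylor_coeff f 3 = (4 * c 2 + (c 1)^2) / 16"
    and "taylor_coeff f 4 = (48 * c 3 + 12 * c 1 * c 2 - 13 * (c 1)^3) / 288"
    and "taylor_coeff f 5 = (144 * c 4 + 24 * c 1 * c 3 - 120 * (c 1)^2 * c 2 - 11 * (c 1)^4) / 1152"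
proof -
  define h where "h = log_deriv_quotient f"
  define \<tau> where "\<tau> = (\<lambda>z. tanh (w z))"
  define a where "a = taylor_coeff f"
  define b where "b = taylor_coeff h"
  define t where "t = taylor_coeff \<tau>"
  have w_hol: "w holomorphic_on unit_disc" and w0: "w 0 = 0"
    using w by (auto simp: schwarz_function_def)
  have w_lt: "norm (w z) < 1" if "z \<in> unit_disc" for z
    using w that by (auto simp: schwarz_function_def intro: le_less_trans)
  have f_hol: "f holomorphic_on unit_disc"
    using f(1) by (simp add: class_A_def)
  have h_hol: "h holomorphic_on unit_disc"
    using h by (simp add: h_def)
  have \<tau>_hol: "\<tau> holomorphic_on unit_disc"
    unfolding \<tau>_def
    by (rule holomorphic_on_compose_gen[OF w_hol tanh_holomorphic_disc, unfolded o_def]) (use w_lt in auto)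
  note exps = w_hol[THEN disc_has_fps_expansion] f_hol[THEN disc_has_fps_expansion]
    h_hol[THEN disc_has_fps_expansion] \<tau>_hol[THEN disc_has_fps_expansion]
  define F G T W where "F = fps_expansion f 0" "G = fps_expansion h 0" "T = fps_expansion \<tau> 0" "W = fps_expansion w 0"
  note FGTW = this
  have nths: "F $ n = a n" "G $ n = b n" "T $ n = t n" "W $ n = c n" for n
    by (simp_all add: FGTW a_def b_def t_def c_def taylor_coeff_def)
  have "fps_deriv T = (1 - T * T) * fps_deriv W"
  proof (rule fps_eq_of_eq_on_disc)
    show "deriv \<tau> has_fps_expansion fps_deriv T"
      unfolding FGTW by (intro fps_expansion_intros exps)
    show "(\<lambda>z. (1 - \<tau> z * \<tau> z) * deriv w z) has_fps_expansion (1 - T * T) * fps_deriv W"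
      unfolding FGTW by (intro fps_expansion_intros exps)
    fix z :: complex
    assume z: "z \<in> unit_disc"
    have "(w has_field_derivative deriv w z) (at z)"
      using w_hol z by (auto intro: holomorphic_derivI)
    then have "(\<tau> has_field_derivative (1 - (tanh (w z))\<^sup>2) * deriv w z) (at z)"
      unfolding \<tau>_def using cosh_nonzero_disc[OF w_lt[OF z]] by (intro has_field_derivative_tanh)
    then show "deriv \<tau> z = (1 - \<tau> z * \<tau> z) * deriv w z"
      by (simp add: DERIV_imp_deriv \<tau>_def power2_eq_square)
  qed
  then have T: "fps_deriv T $ n = ((1 - T * T) * fps_deriv W) $ n" for n
    by simp
  \<comment> \<open>Squaring forgets the branch of the root; the value \<open>b 0 = 1\<close>
    established below restores it.\<close>
  have "G * G = 1 + T"
  proof (rule fps_eq_of_eq_on_disc)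
    show "(\<lambda>z. h z * h z) has_fps_expansion G * G"
      unfolding FGTW by (intro fps_expansion_intros exps)
    show "(\<lambda>z. 1 + \<tau> z) has_fps_expansion 1 + T"
      unfolding FGTW by (intro fps_expansion_intros exps)
    show "h z * h z = 1 + \<tau> z" if "z \<in> unit_disc" for z
      using sub[OF that] by (simp add: h_def \<tau>_def bean_function_def flip: power2_eq_square)
  qed
  then have G: "(G * G) $ n = (1 + T) $ n" for n
    by simp
  have "fps_X * fps_deriv F = F * G"
  proof (rule fps_eq_of_eq_on_disc)
    show "(\<lambda>z. z * deriv f z) has_fps_expansion fps_X * fps_deriv F"
      unfolding FGTW by (intro fps_expansion_intros exps)
    show "(\<lambda>z. f z * h z) has_fps_expansion F * G"
      unfolding FGTW by (intro fps_expansion_intros exps)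
    \<comment> \<open>At the origin both sides are 0 because \<open>f 0 = 0\<close>; elsewhere
      \<open>f z\<close> is nonzero and the quotient can be cleared.\<close>
    show "z * deriv f z = f z * h z" if "z \<in> unit_disc" for z
      using f(2)[of z] that class_A_coeffs(1)[OF f(1)] by (simp add: h_def log_deriv_quotient_def)
  qed
  then have F: "(fps_X * fps_deriv F) $ n = (F * G) $ n" for n
    by simp
  have c0: "c 0 = 0" and t0: "t 0 = 0" and b0: "b 0 = 1"
    using w0 by (simp_all add: c_def t_def b_def taylor_coeff_def fps_expansion_def \<tau>_def h_def log_deriv_quotient_def)
  have a0: "a 0 = 0" and a1: "a (Suc 0) = 1"
    using class_A_coeffs[OF f(1)] by (simp_all add: a_def)
  note expand = fps_mult_nth eval_nat_numeral nths c0 t0 b0 a0 a1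
  have t: "t 1 = c 1" "t 2 = c 2" "3 * t 3 = 3 * c 3 - (c 1)^3" "t 4 = c 4 - (c 1)^2 * c 2"
  proof -
    show 1: "t 1 = c 1" and 2: "t 2 = c 2"
      using T[of 0] T[of 1] by (simp_all add: expand)
    show 3: "3 * t 3 = 3 * c 3 - (c 1)^3"
      using T[of 2] 1 2 by (simp add: expand)
    have "4 * t 4 = 4 * (c 4 - (c 1)^2 * c 2)"
      using T[of 3] 1 2 by (simp add: expand right_diff_distrib)
    then show "t 4 = c 4 - (c 1)^2 * c 2"
      by (rule mult_left_cancel[THEN iffD1, rotated]) simp
  qed
  have b: "2 * b 1 = t 1" "2 * b 2 = t 2 - (b 1)^2" "2 * b 3 = t 3 - 2 * b 1 * b 2"
    "2 * b 4 = t 4 - 2 * b 1 * b 3 - (b 2)^2"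
    subgoal using G[of 1] by (simp add: expand)
    subgoal using G[of 2] by (simp add: expand algebra_simps)
    subgoal using G[of 3] by (simp add: expand algebra_simps)
    subgoal using G[of 4] by (simp add: expand algebra_simps)
    done
  \<comment> \<open>Since \<open>b 0 = 1\<close>, the term \<open>a n * b 0\<close> of the product
    cancels one copy of \<open>n * a n\<close>, which leaves the factor \<open>n - 1\<close> on the
    left.\<close>
  have a: "a 2 = b 1" "2 * a 3 = b 2 + a 2 * b 1" "3 * a 4 = b 3 + a 2 * b 2 + a 3 * b 1"
    "4 * a 5 = b 4 + a 2 * b 3 + a 3 * b 2 + a 4 * b 1"
    subgoal using F[of 2] by (simp add: expand)
    subgoal using F[of 3] by (simp add: expand algebra_simps)
    subgoal using F[of 4] by (simp add: expand algebra_simps)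
    subgoal using F[of 5] by (simp add: expand algebra_simps)
    done
  \<comment> \<open>The three recursions are triangular: each equation is solved for its leading
    unknown by dividing by 2, 3 or 4, and earlier values are then substituted.\<close>
  note solve = eq_divide_imp[of "2 :: complex"] eq_divide_imp[of "3 :: complex"] eq_divide_imp[of "4 :: complex"]
  have t3: "t 3 = (3 * c 3 - (c 1)^3) / 3"
    by (rule solve, simp, simp only: mult.commute[of _ 3] t)
  have b1: "b 1 = c 1 / 2"
    by (rule solve, simp, simp only: mult.commute[of _ 2] b t)
  have "b 2 = (t 2 - (b 1)^2) / 2"
    by (rule solve, simp, simp only: mult.commute[of _ 2] b)
  then have b2: "b 2 = c 2 / 2 - (c 1)^2 / 8"
    unfolding t b1 by (rule trans) (simp add: field_simps power2_eq_square)
  have "b 3 = (t 3 - 2 * b 1 * b 2) / 2"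
    by (rule solve, simp, simp only: mult.commute[of _ 2] b)
  then have b3: "b 3 = c 3 / 2 - c 1 * c 2 / 4 - 5 * (c 1)^3 / 48"
    unfolding t3 b1 b2 by (rule trans) (simp add: field_simps power2_eq_square power3_eq_cube)
  have "b 4 = (t 4 - 2 * b 1 * b 3 - (b 2)^2) / 2"
    by (rule solve, simp, simp only: mult.commute[of _ 2] b)
  then have b4: "b 4 = c 4 / 2 - (2 * c 1 * c 3 + (c 2)^2) / 8 - 5 * (c 1)^2 * c 2 / 16 + 17 * (c 1)^4 / 384"
    unfolding t b1 b2 b3 by (rule trans) (simp add: field_simps power_numeral_reduce)
  have a2: "a 2 = c 1 / 2"
    by (simp only: a b1)
  have "a 3 = (b 2 + a 2 * b 1) / 2"
    by (rule solve, simp, simp only: mult.commute[of _ 2] a)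
  then have a3: "a 3 = (4 * c 2 + (c 1)^2) / 16"
    unfolding a2 b1 b2 by (rule trans) (simp add: field_simps power2_eq_square)
  have "a 4 = (b 3 + a 2 * b 2 + a 3 * b 1) / 3"
    by (rule solve, simp, simp only: mult.commute[of _ 3] a)
  then have a4: "a 4 = (48 * c 3 + 12 * c 1 * c 2 - 13 * (c 1)^3) / 288"
    unfolding a3 a2 b1 b2 b3 by (rule trans) (simp add: field_simps power_numeral_reduce)
  have "a 5 = (b 4 + a 2 * b 3 + a 3 * b 2 + a 4 * b 1) / 4"
    by (rule solve, simp, simp only: mult.commute[of _ 4] a)
  then have a5: "a 5 = (144 * c 4 + 24 * c 1 * c 3 - 120 * (c 1)^2 * c 2 - 11 * (c 1)^4) / 1152"
    unfolding a4 a3 a2 b1 b2 b3 b4 by (rule trans) (simp add: field_simps power_numeral_reduce)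
  show "taylor_coeff f 3 = (4 * c 2 + (c 1)^2) / 16"
    and "taylor_coeff f 4 = (48 * c 3 + 12 * c 1 * c 2 - 13 * (c 1)^3) / 288"
    and "taylor_coeff f 5 = (144 * c 4 + 24 * c 1 * c 3 - 120 * (c 1)^2 * c 2 - 11 * (c 1)^4) / 1152"
    using a3 a4 a5 by (simp_all only: a_def)
qed

section \<open>The bound and its sharpness\<close>

text \<open>This is the Schur step with first parameter \<open>w 0 = 0\<close>, where the relation
  collapses to \<open>w z = z * s z\<close>; hence the index shift by one.\<close>

lemma schwarz_function_factor:
  assumes w: "schwarz_function w"
  obtains s where "s \<in> schur_class" "\<And>n. taylor_coeff w (Suc n) = taylor_coeff s n"
proof -
  have "norm (w z) \<le> 1" if "z \<in> unit_disc" for z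
    using w that by (auto simp: schwarz_function_def intro!: order_trans[of "norm (w z)" "norm z" 1])
  then have "w \<in> schur_class"
    using w by (simp add: schur_class_def schwarz_function_def)
  then obtain s where s: "s \<in> schur_class"
    "fps_expansion w 0 * (1 + fps_const (cnj (taylor_coeff w 0)) * (fps_X * fps_expansion s 0))
      = fps_const (taylor_coeff w 0) + fps_X * fps_expansion s 0"
    using schur_step_fps by blast
  moreover have "taylor_coeff w 0 = 0"
    using w by (simp add: taylor_coeff_def fps_expansion_def schwarz_function_def)
  ultimately have "fps_expansion w 0 = fps_X * fps_expansion s 0"
    by simp
  then have "taylor_coeff w (Suc n) = taylor_coeff s n" for n
    by (simp add: taylor_coeff_def)
  then show ?thesis
    using that s(1) by blast
qed

lemma hankel_2_3_SB:
  assumes f: "f \<in> class_A" "\<And>z. z \<in> unit_disc - {0} \<Longrightarrow> f z \<noteq> 0"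
    and w: "schwarz_function w"
    and h: "log_deriv_quotient f holomorphic_on unit_disc"
    and sub: "\<And>z. z \<in> unit_disc \<Longrightarrow> log_deriv_quotient f z = bean_function (w z)"
  defines "c \<equiv> taylor_coeff w"
  shows "hankel_2_3 f = (4 * c 2 + (c 1)^2) / 16 *
      ((144 * c 4 + 24 * c 1 * c 3 - 120 * (c 1)^2 * c 2 - 11 * (c 1)^4) / 1152)
      - ((48 * c 3 + 12 * c 1 * c 2 - 13 * (c 1)^3) / 288)^2"
  unfolding hankel_2_3_def c_def by (simp only: SB_coeffs[OF f w h sub])

text \<open>After \<open>w z = z * s z\<close>, three further Schur steps yield \<open>s1\<close>,
  \<open>s2\<close>, \<open>s3\<close>; the values of \<open>s\<close>, \<open>s1\<close>,
  \<open>s2\<close>, \<open>s3\<close> at 0 are the parameters \<open>c\<close>, \<open>x\<close>,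
  \<open>y\<close>, \<open>z\<close>. Each step reaches one coefficient fewer, so four parameters
  account for the four coefficients of \<open>w\<close> that occur.\<close>

lemma hankel_2_3_SB_le:
  assumes "f \<in> class_SB"
  shows "norm (hankel_2_3 f) \<le> 1 / 36"
proof -
  obtain w where f: "f \<in> class_A" "\<And>z. z \<in> unit_disc - {0} \<Longrightarrow> f z \<noteq> 0"
    and w: "schwarz_function w"
    and h: "log_deriv_quotient f holomorphic_on unit_disc"
    and sub: "\<And>z. z \<in> unit_disc \<Longrightarrow> log_deriv_quotient f z = bean_function (w z)"
    using assms unfolding class_SB_def subordinate_def by blast
  obtain s where s: "s \<in> schur_class" "\<And>n. taylor_coeff w (Suc n) = taylor_coeff s n"
    using schwarz_function_factor[OF w] by blast
  obtain s1 where s1: "s1 \<in> schur_class"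
    "taylor_coeff s 1 = (1 - (norm (taylor_coeff s 0))^2) * taylor_coeff s1 0"
    "taylor_coeff s 2 = (1 - (norm (taylor_coeff s 0))^2) * taylor_coeff s1 1
       - cnj (taylor_coeff s 0) * taylor_coeff s1 0 * taylor_coeff s 1"
    "taylor_coeff s 3 = (1 - (norm (taylor_coeff s 0))^2) * taylor_coeff s1 2
       - cnj (taylor_coeff s 0) * (taylor_coeff s1 0 * taylor_coeff s 2 + taylor_coeff s1 1 * taylor_coeff s 1)"
    using schur_coeffs[OF s(1)] by metis
  obtain s2 where s2: "s2 \<in> schur_class"
    "taylor_coeff s1 1 = (1 - (norm (taylor_coeff s1 0))^2) * taylor_coeff s2 0"
    "taylor_coeff s1 2 = (1 - (norm (taylor_coeff s1 0))^2) * taylor_coeff s2 1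
       - cnj (taylor_coeff s1 0) * taylor_coeff s2 0 * taylor_coeff s1 1"
    using schur_coeffs[OF s1(1)] by metis
  obtain s3 where s3: "s3 \<in> schur_class"
    "taylor_coeff s2 1 = (1 - (norm (taylor_coeff s2 0))^2) * taylor_coeff s3 0"
    using schur_coeffs[OF s2(1)] by metis
  have w_s: "taylor_coeff w 1 = taylor_coeff s 0" "taylor_coeff w 2 = taylor_coeff s 1"
    "taylor_coeff w 3 = taylor_coeff s 2" "taylor_coeff w 4 = taylor_coeff s 3"
    using s(2)[of 0] s(2)[of 1] s(2)[of 2] s(2)[of 3] by (simp_all add: eval_nat_numeral)
  have "norm ((4 * taylor_coeff s 1 + (taylor_coeff s 0)^2) / 16 *
      ((144 * taylor_coeff s 3 + 24 * taylor_coeff s 0 * taylor_coeff s 2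
        - 120 * (taylor_coeff s 0)^2 * taylor_coeff s 1 - 11 * (taylor_coeff s 0)^4) / 1152)
      - ((48 * taylor_coeff s 2 + 12 * taylor_coeff s 0 * taylor_coeff s 1
        - 13 * (taylor_coeff s 0)^3) / 288)^2) \<le> 1 / 36"
  proof (rule hankel_schur_bound[OF _ _ _ _ refl refl refl])
    show "norm (taylor_coeff s 0) \<le> 1" "norm (taylor_coeff s1 0) \<le> 1"
      "norm (taylor_coeff s2 0) \<le> 1" "norm (taylor_coeff s3 0) \<le> 1"
      using s(1) s1(1) s2(1) s3(1) by (simp_all add: taylor_coeff_0_schur)
    show "taylor_coeff s 1 = (1 - (norm (taylor_coeff s 0))^2) * taylor_coeff s1 0"
      by (rule s1(2))
    show "taylor_coeff s 2 = (1 - (norm (taylor_coeff s 0))^2) *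
        ((1 - (norm (taylor_coeff s1 0))^2) * taylor_coeff s2 0
         - cnj (taylor_coeff s 0) * (taylor_coeff s1 0)^2)"
      unfolding s1(3) s1(2) s2(2) by algebra
    show "taylor_coeff s 3 = complex_of_real (1 - (norm (taylor_coeff s 0))^2) *
        (complex_of_real (1 - (norm (taylor_coeff s1 0))^2) *
          complex_of_real (1 - (norm (taylor_coeff s2 0))^2) * taylor_coeff s3 0
         - (1 - (norm (taylor_coeff s1 0))^2) * cnj (taylor_coeff s1 0) * (taylor_coeff s2 0)^2
         - 2 * cnj (taylor_coeff s 0) * (1 - (norm (taylor_coeff s1 0))^2) * taylor_coeff s1 0 * taylor_coeff s2 0
         + (cnj (taylor_coeff s 0))^2 * (taylor_coeff s1 0)^3)"
      unfolding s1(4) s1(3) s1(2) s2(3) s2(2) s3(2) by algebra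
  qed
  then show ?thesis
    using hankel_2_3_SB[OF f w h sub] by (simp only: w_s)
qed

section \<open>Construction of the extremal function\<close>

lemma class_A_I:
  assumes hol: "f holomorphic_on unit_disc" and "f 0 = 0" "deriv f 0 = 1"
  shows "f \<in> class_A"
proof -
  have c: "taylor_coeff f 0 = 0" "taylor_coeff f (Suc 0) = 1"
    using assms by (simp_all add: taylor_coeff_def fps_expansion_def)
  have "(\<lambda>n. taylor_coeff f (n + 2) * z ^ (n + 2)) sums (f z - z)" if z: "z \<in> unit_disc" for z
  proof -
    have "(\<lambda>n. taylor_coeff f n * z ^ n) sums f z"
      unfolding taylor_coeff_def
      by (rule has_fps_expansion_imp_sums_complex[OF disc_has_fps_expansion[OF hol], of 1])
        (use hol z in \<open>simp_all add: one_ereal_def\<close>)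
    then have "(\<lambda>n. taylor_coeff f (n + 2) * z ^ (n + 2)) sums
        (f z - (\<Sum>i<2. taylor_coeff f i * z ^ i))"
      by (rule sums_split_initial_segment)
    then show ?thesis
      using c by (simp add: eval_nat_numeral)
  qed
  then show ?thesis
    using hol by (simp add: class_A_def)
qed

text \<open>The equation \<open>z * f' / f = h\<close> is solved by
  \<open>f z = z * exp (g z - g 0)\<close>, where \<open>g\<close> is a primitive of
  \<open>(h z - 1) / z\<close>. That quotient is analytic because \<open>h 0 = 1\<close>, and the
  exponential keeps \<open>f\<close> nonzero off the origin.\<close>

lemma starlike_with_quotient:
  assumes h: "h holomorphic_on unit_disc" "h 0 = 1"
  obtains f where "f \<in> class_A" "\<And>z. z \<in> unit_disc - {0} \<Longrightarrow> f z \<noteq> 0"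
    "\<And>z. z \<in> unit_disc \<Longrightarrow> log_deriv_quotient f z = h z"
proof -
  have "(\<lambda>z. h z - 1) holomorphic_on unit_disc"
    using h(1) by (intro holomorphic_intros)
  then obtain k where k: "k holomorphic_on unit_disc" "\<And>z. norm z < 1 \<Longrightarrow> h z - 1 = z * k z"
    using Schwarz3[of "\<lambda>z. h z - 1" 1] h(2) by auto
  obtain g where "\<And>z. z \<in> unit_disc \<Longrightarrow> (g has_field_derivative k z) (at z within unit_disc)"
    using holomorphic_convex_primitive'[OF convex_ball open_ball k(1)] by blast
  then have g: "(g has_field_derivative k z) (at z)" if "z \<in> unit_disc" for z
    using that by (metis at_within_open open_ball)
  define f where "f = (\<lambda>z. z * exp (g z - g 0))"
  have f_deriv: "(f has_field_derivative exp (g z - g 0) * h z) (at z)" if z: "z \<in> unit_disc" for z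
  proof -
    have "(f has_field_derivative exp (g z - g 0) * (1 + z * k z)) (at z)"
      unfolding f_def by (rule derivative_eq_intros refl g[OF z])+ (simp add: algebra_simps)
    moreover have "1 + z * k z = h z"
      using k(2)[of z] z by (simp add: algebra_simps)
    ultimately show ?thesis
      by simp
  qed
  show ?thesis
  proof (rule that)
    show "f \<in> class_A"
    proof (rule class_A_I)
      show "f holomorphic_on unit_disc"
        unfolding holomorphic_on_open[OF open_ball] using f_deriv by blast
      show "f 0 = 0"
        by (simp add: f_def)
      show "deriv f 0 = 1"
        using DERIV_imp_deriv[OF f_deriv[of 0]] h(2) by simp
    qed
    show "f z \<noteq> 0" if "z \<in> unit_disc - {0}" for z
      using that by (simp add: f_def)
    \<comment> \<open>At the origin the quotient is 1 by definition, which agrees with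
      \<open>h 0 = 1\<close>.\<close>
    show "log_deriv_quotient f z = h z" if "z \<in> unit_disc" for z
      using DERIV_imp_deriv[OF f_deriv[OF that]] h(2)
      by (simp add: log_deriv_quotient_def) (simp add: f_def)
  qed
qed

lemma hankel_2_3_SB_sharp: "\<exists>f\<in>class_SB. norm (hankel_2_3 f) = 1 / 36"
proof -
  define w :: "complex \<Rightarrow> complex" where "w = (\<lambda>z. z^3)"
  have w_hol: "w holomorphic_on unit_disc"
    unfolding w_def by (intro holomorphic_intros)
  have w: "schwarz_function w"
    using w_hol power_decreasing[of 1 3 "norm z" for z :: complex]
    by (auto simp: schwarz_function_def w_def norm_power)
  then have "w ` unit_disc \<subseteq> unit_disc"
    by (auto simp: schwarz_function_def intro: le_less_trans)
  then have h_hol: "(\<lambda>z. bean_function (w z)) holomorphic_on unit_disc"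
    using holomorphic_on_compose_gen[OF w_hol bean_function_holomorphic] by (simp add: o_def)
  moreover have "bean_function (w 0) = 1"
    by (simp add: w_def bean_function_def)
  ultimately obtain f where f: "f \<in> class_A" "\<And>z. z \<in> unit_disc - {0} \<Longrightarrow> f z \<noteq> 0"
    "\<And>z. z \<in> unit_disc \<Longrightarrow> log_deriv_quotient f z = bean_function (w z)"
    using starlike_with_quotient by blast
  have l_hol: "log_deriv_quotient f holomorphic_on unit_disc"
    by (rule holomorphic_transform[OF h_hol]) (simp add: f(3))
  have "f \<in> class_SB"
    using f w l_hol bean_function_holomorphic by (auto simp: class_SB_def subordinate_def)
  moreover have "norm (hankel_2_3 f) = 1 / 36"
  proof -
    have "w has_fps_expansion fps_X ^ 3"
      unfolding w_def by (rule has_fps_expansion_fps_X_power)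
    then have "taylor_coeff w n = (if n = 3 then 1 else 0)" for n
      by (simp add: taylor_coeff_def fps_expansion_eqI fps_X_power_nth)
    \<comment> \<open>Only the coefficient of index 3 survives, so \<open>a_3 = a_5 = 0\<close> and
      \<open>a_4 = 48 / 288 = 1 / 6\<close>; the determinant is -1/36.\<close>
    then show ?thesis
      using hankel_2_3_SB[OF f(1,2) w l_hol f(3)] by (simp add: norm_divide norm_power power2_eq_square)
  qed
  ultimately show ?thesis
    by blast
qed

theorem theorem2p6:
  shows "(\<forall>f\<in>class_SB. norm (hankel_2_3 f) \<le> 1 / 36) \<and>
         (\<exists>f\<in>class_SB. norm (hankel_2_3 f) = 1 / 36)"
  using hankel_2_3_SB_le hankel_2_3_SB_sharp by blast

end
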